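(* Let $\mathcal{S}$ be a set, let $O\in\mathcal{S}$, and let $\Omega\subseteq\mathcal{S}_{\rm nc}$ be a nonempty set closed under direct sums of matrices. Let $f\colon\Omega\to\Omega$ satisfy: (i) $f(\Omega_n)\subseteq\Omega_n$ for every $n\in\operatorname{supp}\Omega$; (ii) $f$ respects direct sums: $f(X\oplus Y)=f(X)\oplus f(Y)$ for all $X,Y\in\Omega$; (iii) for every $n\in\operatorname{supp}\Omega$ the mapping $f|_{\Omega_n}$ has a unique fixed point, denoted $X_{*n}$. Let $d=\gcd\{n\colon n\in\operatorname{supp}\Omega\}$. Then: 1. There exists $X_*\in\mathcal{S}^{d\times d}$ such that $X_{*n}=\bigoplus_{\alpha=1}^{n/d}X_*$ for every $n\in\operatorname{supp}\Omega$. 2. If, moreover, $\mathcal{S}=\mathcal{M}$ is a bi-module over a unital ring $\mathcal{R}$, $O=0\in\mathcal{M}$, and $f$ is a nc function, then there exist a nc set $\tilde\Omega\subseteq\mathcal{M}_{\rm nc}$ with $\tilde\Omega\supseteq\Omega$ and $\operatorname{supp}\tilde\Omega=\mathbb{N}d$, and a nc function $\tilde f\colon\tilde\Omega\to\tilde\Omega$, such that $\tilde f|_\Omega=f$ and, for every $n\in\mathbb{N}d$, the mapping $\tilde f|_{\tilde\Omega_n}$ has a unique fixed point, namely $X_{*n}=\bigoplus_{\alpha=1}^{n/d}X_*$.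
   Context: For a set $\mathcal{S}$, $\mathcal{S}^{n\times n}$ is the set of $n\times n$ matrices (arrays) with entries in $\mathcal{S}$, with no algebraic structure assumed, and $\mathcal{S}_{\rm nc}:=\coprod_{n=1}^\infty\mathcal{S}^{n\times n}$. For $\Omega\subseteq\mathcal{S}_{\rm nc}$ write $\Omega_n:=\Omega\cap\mathcal{S}^{n\times n}$ and $\operatorname{supp}\Omega:=\{n\in\mathbb{N}\colon\Omega_n\neq\emptyset\}$, where $\mathbb{N}=\{1,2,\dots\}$. $\mathbb{N}d=\{d,2d,3d,\dots\}$. With a fixed element $O\in\mathcal{S}$, the direct sum of $X\in\mathcal{S}^{n\times n}$ and $Y\in\mathcal{S}^{m\times m}$ is the block matrix $X\oplus Y:=\begin{bmatrix}X&\mathbf{O}_{n\times m}\\ \mathbf{O}_{m\times n}&Y\end{bmatrix}\in\mathcal{S}^{(n+m)\times(n+m)}$, where $\mathbf{O}_{p\times q}$ is the $p\times q$ matrix all of whose entries equal $O$. $\bigoplus_{\alpha=1}^kX$ is the direct sum of $k$ copies of $X$. $\Omega$ is closed under (respects) direct sums if $X\in\Omega_n$, $Y\in\Omega_m$ imply $X\oplus Y\in\Omega_{n+m}$. If $\mathcal{M}$ is a bi-module over a unital ring $\mathcal{R}$ (and $O=0$), a subset of $\mathcal{M}_{\rm nc}$ closed under direct sums is called a nc set. Matrices over $\mathcal{R}$ act on matrices over $\mathcal{M}$ from the left and from the right by the usual matrix multiplication. For a nc set $\Omega\subseteq\mathcal{M}_{\rm nc}$ and a bi-module $\mathcal{N}$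 over $\mathcal{R}$, a mapping $f\colon\Omega\to\mathcal{N}_{\rm nc}$ with $f(\Omega_n)\subseteq\mathcal{N}^{n\times n}$ for all $n$ is a nc function if it respects direct sums ($f(X\oplus Y)=f(X)\oplus f(Y)$ for all $X,Y\in\Omega$) and respects similarities (if $X\in\Omega_n$ and $S\in\mathcal{R}^{n\times n}$ is invertible with $SXS^{-1}\in\Omega_n$, then $f(SXS^{-1})=Sf(X)S^{-1}$). *)

theory Defs
  imports "Jordan_Normal_Form.Matrix"
begin

definition nc_space :: "'a mat set" where
  "nc_space = (\<Union>n\<in>{1..}. carrier_mat n n)"

definition level :: "'a mat set \<Rightarrow> nat \<Rightarrow> 'a mat set" where
  "level \<Omega> n = \<Omega> \<inter> carrier_mat n n"

definition nc_supp :: "'a mat set \<Rightarrow> nat set" where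
  "nc_supp \<Omega> = {n. 1 \<le> n \<and> level \<Omega> n \<noteq> {}}"

text \<open>The argument \<open>z\<close> is the element used to fill the off-diagonal blocks.\<close>

definition dsum :: "'a \<Rightarrow> 'a mat \<Rightarrow> 'a mat \<Rightarrow> 'a mat" where
  "dsum z X Y = four_block_mat
     X (mat (dim_row X) (dim_col Y) (\<lambda>_. z))
     (mat (dim_row Y) (dim_col X) (\<lambda>_. z)) Y"

primrec dsum_copies :: "'a \<Rightarrow> nat \<Rightarrow> 'a mat \<Rightarrow> 'a mat" where
  "dsum_copies z 0 X = mat 0 0 (\<lambda>_. z)"
| "dsum_copies z (Suc k) X = dsum z X (dsum_copies z k X)"

definition dsum_closed :: "'a \<Rightarrow> 'a mat set \<Rightarrow> bool" where
  "dsum_closed z \<Omega> \<longleftrightarrow> (\<forall>X\<in>\<Omega>. \<forall>Y\<in>\<Omega>. dsum z X Y \<in> \<Omega>)"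

definition respects_dsum :: "'a \<Rightarrow> 'b \<Rightarrow> 'a mat set \<Rightarrow> ('a mat \<Rightarrow> 'b mat) \<Rightarrow> bool" where
  "respects_dsum z w \<Omega> f \<longleftrightarrow> (\<forall>X\<in>\<Omega>. \<forall>Y\<in>\<Omega>. f (dsum z X Y) = dsum w (f X) (f Y))"

definition is_unique_fixpoint :: "('b \<Rightarrow> 'b) \<Rightarrow> 'b set \<Rightarrow> 'b \<Rightarrow> bool" where
  "is_unique_fixpoint f A x \<longleftrightarrow> x \<in> A \<and> f x = x \<and> (\<forall>y\<in>A. f y = y \<longrightarrow> y = x)"

text \<open>Unlike \<^class>\<open>ring_1\<close>, this class does not exclude the zero ring.\<close>

class unital_ring = ring + monoid_mult

locale bimodule =
  fixes lscale :: "'r::unital_ring \<Rightarrow> 'm::ab_group_add \<Rightarrow> 'm"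
    and rscale :: "'m \<Rightarrow> 'r \<Rightarrow> 'm"
  assumes lscale_add_right: "lscale a (x + y) = lscale a x + lscale a y"
    and lscale_add_left: "lscale (a + b) x = lscale a x + lscale b x"
    and lscale_lscale: "lscale a (lscale b x) = lscale (a * b) x"
    and lscale_one: "lscale 1 x = x"
    and rscale_add_left: "rscale (x + y) a = rscale x a + rscale y a"
    and rscale_add_right: "rscale x (a + b) = rscale x a + rscale x b"
    and rscale_rscale: "rscale (rscale x a) b = rscale x (a * b)"
    and rscale_one: "rscale x 1 = x"
    and lscale_rscale: "rscale (lscale a x) b = lscale a (rscale x b)"

definition lmult_mat ::
  "('r \<Rightarrow> 'm \<Rightarrow> 'm) \<Rightarrow> 'r mat \<Rightarrow> 'm::comm_monoid_add mat \<Rightarrow> 'm mat" where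
  "lmult_mat lscale S X = mat (dim_row S) (dim_col X)
     (\<lambda>(i, j). \<Sum>k<dim_row X. lscale (S $$ (i, k)) (X $$ (k, j)))"

definition rmult_mat ::
  "('m \<Rightarrow> 'r \<Rightarrow> 'm) \<Rightarrow> 'm::comm_monoid_add mat \<Rightarrow> 'r mat \<Rightarrow> 'm mat" where
  "rmult_mat rscale X S = mat (dim_row X) (dim_col S)
     (\<lambda>(i, j). \<Sum>k<dim_col X. rscale (X $$ (i, k)) (S $$ (k, j)))"

definition nc_set :: "'m::ab_group_add mat set \<Rightarrow> bool" where
  "nc_set \<Omega> \<longleftrightarrow> \<Omega> \<subseteq> nc_space \<and> dsum_closed 0 \<Omega>"

definition respects_sim ::
  "('r::unital_ring \<Rightarrow> 'm::ab_group_add \<Rightarrow> 'm) \<Rightarrow> ('m \<Rightarrow> 'r \<Rightarrow> 'm) \<Rightarrow>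
   ('r \<Rightarrow> 'n::ab_group_add \<Rightarrow> 'n) \<Rightarrow> ('n \<Rightarrow> 'r \<Rightarrow> 'n) \<Rightarrow>
   'm mat set \<Rightarrow> ('m mat \<Rightarrow> 'n mat) \<Rightarrow> bool" where
  "respects_sim lM rM lN rN \<Omega> f \<longleftrightarrow>
     (\<forall>n. \<forall>X\<in>level \<Omega> n. \<forall>S\<in>carrier_mat n n. \<forall>T\<in>carrier_mat n n.
        S * T = 1\<^sub>m n \<longrightarrow> T * S = 1\<^sub>m n \<longrightarrow>
        rmult_mat rM (lmult_mat lM S X) T \<in> level \<Omega> n \<longrightarrow>
        f (rmult_mat rM (lmult_mat lM S X) T) = rmult_mat rN (lmult_mat lN S (f X)) T)"

text \<open>A mapping on \<open>\<Omega>\<close> is a total function of which only the values on \<open>\<Omega>\<close> matter.\<close>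

definition nc_function ::
  "('r::unital_ring \<Rightarrow> 'm::ab_group_add \<Rightarrow> 'm) \<Rightarrow> ('m \<Rightarrow> 'r \<Rightarrow> 'm) \<Rightarrow>
   ('r \<Rightarrow> 'n::ab_group_add \<Rightarrow> 'n) \<Rightarrow> ('n \<Rightarrow> 'r \<Rightarrow> 'n) \<Rightarrow>
   'm mat set \<Rightarrow> ('m mat \<Rightarrow> 'n mat) \<Rightarrow> bool" where
  "nc_function lM rM lN rN \<Omega> f \<longleftrightarrow>
     (\<forall>n. f ` level \<Omega> n \<subseteq> carrier_mat n n) \<and>
     respects_dsum 0 0 \<Omega> f \<and> respects_sim lM rM lN rN \<Omega> f"

end

theory Submission imports Defs begin

text \<open>
  Uniqueness of fixed points gives \<open>X\<^sub>n \<oplus> X\<^sub>m = X\<^sub>n\<^sub>+\<^sub>m = X\<^sub>m \<oplus> X\<^sub>n\<close>. All large multiples of \<open>d\<close> lie in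
  the support, so one may compare two sizes \<open>a\<close> and \<open>a + d\<close>: this splits \<open>X\<^sub>a\<^sub>+\<^sub>d\<close> as \<open>X\<^sub>a \<oplus> X\<^sub>*\<close>, and
  cancellation shows that \<open>X\<^sub>*\<close> commutes with every \<open>X\<^sub>n\<close>, whence \<open>X\<^sub>n\<close> is a direct sum of copies
  of \<open>X\<^sub>*\<close>.

  For the extension, \<open>\<Omega>'\<close> consists of the direct sums of elements of \<open>\<Omega>\<close> and copies of \<open>X\<^sub>*\<close>, and
  \<open>f'\<close> acts summand by summand, fixing \<open>X\<^sub>*\<close>. If \<open>Z\<close> is such a sum, \<open>W\<close> its summandwise image, and
  \<open>N\<close> is large, then \<open>Z \<oplus> X\<^sub>*\<^sup>N\<close> and \<open>W \<oplus> X\<^sub>*\<^sup>N\<close> are carried by one common permutation of blocks to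
  some \<open>Y \<in> \<Omega>\<close> and to \<open>f Y\<close>. Hence similarity invariance of \<open>f\<close> makes \<open>f'\<close> well defined and
  invariant under similarities.
\<close>

section \<open>Additive semigroups of natural numbers\<close>

lemma add_closed_mult_mem:
  fixes S :: "nat set"
  assumes "\<And>a b. a \<in> S \<Longrightarrow> b \<in> S \<Longrightarrow> a + b \<in> S" and "a \<in> S" and "k \<ge> 1"
  shows "k * a \<in> S"
  using \<open>k \<ge> 1\<close> by (induction k rule: dec_induct) (use assms in auto)

text \<open>The least positive difference \<open>e\<close> of two elements of \<open>S\<close> is
  the gcd: an element of \<open>S\<close> leaving a nonzero remainder modulo \<open>e\<close> would
  produce a smaller difference.\<close>

lemma add_closed_consecutive_multiples:
  fixes S :: "nat set"
  assumes add: "\<And>a b. a \<in> S \<Longrightarrow> b \<in> S \<Longrightarrow> a + b \<in> S" and ne: "S \<noteq> {}" and pos: "0 \<notin> S"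
  shows "\<exists>b\<in>S. b + Gcd S \<in> S"
proof -
  define D where "D = {e. e > 0 \<and> (\<exists>b\<in>S. b + e \<in> S)}"
  obtain n where n: "n \<in> S" using ne by blast
  \<comment> \<open>Both \<open>n\<close> and \<open>n + n\<close> lie in \<open>S\<close>.\<close>
  have "n \<in> D" using n pos add unfolding D_def by (metis (mono_tags, lifting) mem_Collect_eq neq0_conv)
  define e where "e = (LEAST e. e \<in> D)"
  have eD: "e \<in> D" unfolding e_def using \<open>n \<in> D\<close> by (rule LeastI)
  have least: "e \<le> x" if "x \<in> D" for x unfolding e_def using that by (rule Least_le)
  obtain b where b: "b \<in> S" "b + e \<in> S" "e > 0" using eD unfolding D_def by blast
  have "e dvd m" if m: "m \<in> S" for m
  proof (rule ccontr)
    assume "\<not> e dvd m"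
    then have r: "0 < m mod e" by (simp add: dvd_eq_mod_eq_0)
    define q where "q = m div e"
    \<comment> \<open>Trading \<open>q\<close> copies of \<open>e\<close> for \<open>m\<close>
      leaves exactly the remainder as the difference of these two sums. The extra \<open>b\<close>
      keeps both of them in \<open>S\<close> when \<open>q = 0\<close>, since \<open>0\<close>
      itself is excluded.\<close>
    have "q * (b + e) + b \<in> S \<and> q * b + m + b \<in> S"
    proof (cases "q = 0")
      case False
      then show ?thesis using add add_closed_mult_mem[OF add] b m by (metis One_nat_def Suc_leI neq0_conv)
    qed (use add b m in auto)
    moreover have "q * b + m + b = (q * (b + e) + b) + m mod e"
      using div_mult_mod_eq[of m e] unfolding q_def by (simp add: algebra_simps)
    ultimately have "m mod e \<in> D" using r unfolding D_def by (metis (mono_tags, lifting) mem_Collect_eq)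
    then show False using least[of "m mod e"] mod_less_divisor[OF \<open>e > 0\<close>, of m] by linarith
  qed
  then have "e dvd Gcd S" by (simp add: Gcd_greatest)
  moreover have "Gcd S dvd e"
    using b Gcd_dvd[of b S] Gcd_dvd[of "b + e" S] by (simp add: dvd_add_right_iff)
  ultimately have "Gcd S = e" by (simp add: dvd_antisym)
  then show ?thesis using b by blast
qed

text \<open>With \<open>g\<close> the gcd, some \<open>m * g\<close> and \<open>(m + 1) * g\<close>
  lie in \<open>S\<close>, and together they represent every \<open>N * g\<close> with
  \<open>N \<ge> m * m\<close>: the coin problem for consecutive denominations.\<close>

lemma add_closed_eventually_multiples:
  fixes S :: "nat set"
  assumes add: "\<And>a b. a \<in> S \<Longrightarrow> b \<in> S \<Longrightarrow> a + b \<in> S" and ne: "S \<noteq> {}" and pos: "0 \<notin> S"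
  shows "\<exists>N0. \<forall>N\<ge>N0. N * Gcd S \<in> S"
proof -
  obtain b where b: "b \<in> S" "b + Gcd S \<in> S"
    using add_closed_consecutive_multiples[OF assms] by blast
  obtain m where m: "b = Gcd S * m" using Gcd_dvd[OF b(1)] by blast
  have "m > 0" using m b(1) pos by (metis mult_0_right neq0_conv)
  have "N * Gcd S \<in> S" if N: "N \<ge> m * m" for N
  proof -
    define q r where "q = N div m" and "r = N mod m"
    have r: "r < m" unfolding r_def using \<open>m > 0\<close> by simp
    \<comment> \<open>Since \<open>q \<ge> m > r\<close>, the number \<open>t = q - r\<close> is
      positive, and \<open>N\<close> is the sum of \<open>t\<close> copies of \<open>m\<close> and
      \<open>r\<close> copies of \<open>m + 1\<close>.\<close>
    have "q \<ge> m" unfolding q_def using N \<open>m > 0\<close> by (simp add: less_eq_div_iff_mult_less_eq)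
    then obtain t where t: "q = t + r" "t \<ge> 1" using r that[of "q - r"] by simp
    have "N = q * m + r" unfolding q_def r_def by simp
    then have "N * Gcd S = t * b + r * (b + Gcd S)" using t m by (simp add: algebra_simps)
    moreover have "t * b \<in> S" using add_closed_mult_mem[OF add b(1) t(2)] .
    moreover have "r = 0 \<or> r * (b + Gcd S) \<in> S" using add_closed_mult_mem[of S "b + Gcd S" r] add b(2) by force
    ultimately show ?thesis using add by auto
  qed
  then show ?thesis by blast
qed

section \<open>Direct sums of square matrices\<close>

lemma dsum_carrier [simp, intro]:
  "A \<in> carrier_mat n n \<Longrightarrow> B \<in> carrier_mat m m \<Longrightarrow> dsum z A B \<in> carrier_mat (n + m) (n + m)"
  unfolding dsum_def by auto

lemma dsum_index:
  assumes "A \<in> carrier_mat n n" "B \<in> carrier_mat m m" "i < n + m" "j < n + m"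
  shows "dsum z A B $$ (i, j) =
    (if i < n then if j < n then A $$ (i, j) else z
     else if j < n then z else B $$ (i - n, j - n))"
  using assms unfolding dsum_def by auto

lemma dsum_assoc:
  assumes "A \<in> carrier_mat n n" "B \<in> carrier_mat m m" "C \<in> carrier_mat k k"
  shows "dsum z (dsum z A B) C = dsum z A (dsum z B C)"
proof (rule eq_matI)
  note AB = dsum_carrier[OF assms(1,2), of z] and BC = dsum_carrier[OF assms(2,3), of z]
  note L = dsum_carrier[OF AB assms(3), of z] and R = dsum_carrier[OF assms(1) BC, of z]
  show "dim_row (dsum z (dsum z A B) C) = dim_row (dsum z A (dsum z B C))"
    "dim_col (dsum z (dsum z A B) C) = dim_col (dsum z A (dsum z B C))"
    using L R by auto
  fix i j assume "i < dim_row (dsum z A (dsum z B C))" "j < dim_col (dsum z A (dsum z B C))"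
  then have ij: "i < n + m + k" "j < n + m + k" using R by auto
  then show "dsum z (dsum z A B) C $$ (i, j) = dsum z A (dsum z B C) $$ (i, j)"
    by (auto simp: dsum_index[OF AB assms(3)] dsum_index[OF assms(1) BC]
        dsum_index[OF assms(1,2)] dsum_index[OF assms(2,3)])
qed

lemma dsum_cancel:
  assumes A: "A \<in> carrier_mat n n" and A': "A' \<in> carrier_mat n n"
    and B: "B \<in> carrier_mat m m" and B': "B' \<in> carrier_mat m m"
    and eq: "dsum z A B = dsum z A' B'"
  shows "A = A'" "B = B'"
proof -
  have *: "dsum z A B $$ (i, j) = dsum z A' B' $$ (i, j)" for i j using eq by simp
  show "A = A'"
  proof (rule eq_matI)
    fix i j assume "i < dim_row A'" "j < dim_col A'"
    then show "A $$ (i, j) = A' $$ (i, j)"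
      using *[of i j] A' by (auto simp: dsum_index[OF A B] dsum_index[OF A' B'])
  qed (use A A' in auto)
  show "B = B'"
  proof (rule eq_matI)
    fix i j assume "i < dim_row B'" "j < dim_col B'"
    then show "B $$ (i, j) = B' $$ (i, j)"
      using *[of "n + i" "n + j"] B' by (auto simp: dsum_index[OF A B] dsum_index[OF A' B'])
  qed (use B B' in auto)
qed

text \<open>The leading block of size \<open>n + m\<close> is \<open>B\<close> in
  \<open>dsum z B A\<close>, while in \<open>dsum z A B\<close> it has \<open>A\<close> in the
  corner and \<open>z\<close> in the rest of its first \<open>n\<close> rows and columns. So
  \<open>B\<close> has this shape, and \<open>C\<close> is its lower right corner.\<close>

lemma dsum_commute_split:
  assumes A: "A \<in> carrier_mat n n" and B: "B \<in> carrier_mat (n + m) (n + m)"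
    and eq: "dsum z A B = dsum z B A"
  obtains C where "C \<in> carrier_mat m m" "B = dsum z A C"
proof
  let ?C = "mat m m (\<lambda>(i, j). B $$ (n + i, n + j))"
  show C: "?C \<in> carrier_mat m m" by simp
  have *: "dsum z A B $$ (i, j) = dsum z B A $$ (i, j)" for i j using eq by simp
  show "B = dsum z A ?C"
  proof (rule eq_matI)
    fix i j assume "i < dim_row (dsum z A ?C)" "j < dim_col (dsum z A ?C)"
    then have ij: "i < n + m" "j < n + m" using dsum_carrier[OF A C, of z] by auto
    then show "B $$ (i, j) = dsum z A ?C $$ (i, j)"
      using *[of i j] by (auto simp: dsum_index[OF A C] dsum_index[OF A B] dsum_index[OF B A] split: if_splits)
  qed (use B dsum_carrier[OF A C, of z] in auto)
qed

lemma dsum_empty_left [simp]: "dsum z (mat 0 0 g) A = A"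
  unfolding dsum_def by (rule eq_matI) auto

lemma dsum_empty_right [simp]: "dsum z A (mat 0 0 g) = A"
  unfolding dsum_def by (rule eq_matI) auto

lemma dsum_copies_carrier [simp, intro]:
  "A \<in> carrier_mat n n \<Longrightarrow> dsum_copies z k A \<in> carrier_mat (k * n) (k * n)"
  by (induction k) auto

lemma dsum_copies_add:
  assumes "A \<in> carrier_mat n n"
  shows "dsum_copies z (k + l) A = dsum z (dsum_copies z k A) (dsum_copies z l A)"
proof (induction k)
  case (Suc k)
  then show ?case
    using dsum_assoc[OF assms dsum_copies_carrier[OF assms] dsum_copies_carrier[OF assms], of z z k z l]
    by simp
qed simp

text \<open>One copy of \<open>A\<close> is split off \<open>B\<close> at a time. The remainder
  again commutes with \<open>A\<close>, so the induction continues until the size reaches 0.\<close>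

lemma dsum_commute_imp_copies:
  assumes A: "A \<in> carrier_mat n n"
    and "B \<in> carrier_mat (k * n) (k * n)" and "dsum z A B = dsum z B A"
  shows "B = dsum_copies z k A"
  using assms(2,3)
proof (induction k arbitrary: B)
  case 0
  then show ?case by auto
next
  case (Suc k)
  then have "B \<in> carrier_mat (n + k * n) (n + k * n)" by simp
  then obtain C where C: "C \<in> carrier_mat (k * n) (k * n)" "B = dsum z A C"
    using dsum_commute_split[OF A _ Suc.prems(2)] by metis
  \<comment> \<open>Reassociating the commutation of \<open>A\<close> with \<open>dsum z A C\<close>
    exposes a leading \<open>A\<close> on both sides, ready for cancellation.\<close>
  have "dsum z A (dsum z A C) = dsum z A (dsum z C A)"
    using Suc.prems(2) C dsum_assoc[OF A C(1) A] by metis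
  then have "dsum z A C = dsum z C A"
    by (rule dsum_cancel(2)[OF A A dsum_carrier[OF A C(1)], rotated])
      (use dsum_carrier[OF C(1) A, of z] in \<open>simp add: add.commute\<close>)
  then show ?case using Suc.IH[OF C(1)] C(2) by simp
qed

section \<open>The common summand of the fixed points\<close>

lemma mem_level: "X \<in> level \<Omega> n \<longleftrightarrow> X \<in> \<Omega> \<and> X \<in> carrier_mat n n"
  unfolding level_def by simp

locale dsum_fixpoints =
  fixes z :: 'a and \<Omega> :: "'a mat set" and f :: "'a mat \<Rightarrow> 'a mat" and Xfix :: "nat \<Rightarrow> 'a mat"
    and d :: nat
  assumes space: "\<Omega> \<subseteq> nc_space" and nonempty: "\<Omega> \<noteq> {}" and closed: "dsum_closed z \<Omega>"
    and maps: "\<forall>n\<in>nc_supp \<Omega>. f ` level \<Omega> n \<subseteq> level \<Omega> n"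
    and respects: "respects_dsum z z \<Omega> f"
    and unique: "\<forall>n\<in>nc_supp \<Omega>. is_unique_fixpoint f (level \<Omega> n) (Xfix n)"
    and d_def: "d = Gcd (nc_supp \<Omega>)"
begin

lemma dsum_mem: "X \<in> \<Omega> \<Longrightarrow> Y \<in> \<Omega> \<Longrightarrow> dsum z X Y \<in> \<Omega>"
  using closed unfolding dsum_closed_def by blast

lemma f_dsum: "X \<in> \<Omega> \<Longrightarrow> Y \<in> \<Omega> \<Longrightarrow> f (dsum z X Y) = dsum z (f X) (f Y)"
  using respects unfolding respects_dsum_def by blast

lemma mem_cases:
  assumes "X \<in> \<Omega>"
  obtains n where "n \<in> nc_supp \<Omega>" "X \<in> carrier_mat n n" "f X \<in> carrier_mat n n" "f X \<in> \<Omega>"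
proof -
  obtain n where n: "n \<ge> 1" "X \<in> carrier_mat n n" using assms space unfolding nc_space_def by auto
  then have "n \<in> nc_supp \<Omega>" using assms unfolding nc_supp_def level_def by auto
  then show ?thesis using that n assms maps by (fastforce simp: mem_level)
qed

lemma supp_pos: "n \<in> nc_supp \<Omega> \<Longrightarrow> n \<ge> 1"
  unfolding nc_supp_def by simp

lemma Xfix:
  assumes "n \<in> nc_supp \<Omega>"
  shows "Xfix n \<in> \<Omega>" "Xfix n \<in> carrier_mat n n" "f (Xfix n) = Xfix n"
  using assms unique unfolding is_unique_fixpoint_def mem_level by auto

lemma Xfix_unique:
  assumes "n \<in> nc_supp \<Omega>" "X \<in> \<Omega>" "X \<in> carrier_mat n n" "f X = X"
  shows "X = Xfix n"
proof -
  have "\<forall>Y\<in>level \<Omega> n. f Y = Y \<longrightarrow> Y = Xfix n"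
    using unique assms(1) unfolding is_unique_fixpoint_def by blast
  then show ?thesis using assms by (simp add: mem_level)
qed

lemma supp_add:
  assumes "n \<in> nc_supp \<Omega>" "m \<in> nc_supp \<Omega>"
  shows "n + m \<in> nc_supp \<Omega>"
proof -
  have "dsum z (Xfix n) (Xfix m) \<in> level \<Omega> (n + m)"
    using dsum_mem dsum_carrier Xfix assms by (simp add: mem_level)
  then show ?thesis using supp_pos[OF assms(1)] unfolding nc_supp_def by auto
qed

text \<open>The sum is again fixed because \<open>f\<close> respects direct sums, and there is only
  one fixed point of its size.\<close>

lemma Xfix_add:
  assumes "n \<in> nc_supp \<Omega>" "m \<in> nc_supp \<Omega>"
  shows "dsum z (Xfix n) (Xfix m) = Xfix (n + m)"
  using assms by (intro Xfix_unique) (auto simp: supp_add dsum_mem Xfix f_dsum)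

lemma Xfix_commute:
  assumes "n \<in> nc_supp \<Omega>" "m \<in> nc_supp \<Omega>"
  shows "dsum z (Xfix n) (Xfix m) = dsum z (Xfix m) (Xfix n)"
  using Xfix_add assms by (simp add: add.commute)

lemma supp_nonempty: "nc_supp \<Omega> \<noteq> {}"
  using nonempty mem_cases by blast

text \<open>This later places sufficiently long sums of copies of the common summand inside
  \<open>\<Omega>\<close>.\<close>

lemma supp_eventually: "\<exists>N0. \<forall>N\<ge>N0. N * d \<in> nc_supp \<Omega>"
  unfolding d_def using supp_add supp_nonempty supp_pos
  by (intro add_closed_eventually_multiples) fastforce+

lemma d_dvd: "n \<in> nc_supp \<Omega> \<Longrightarrow> d dvd n"
  unfolding d_def by simp

lemma d_pos: "d \<ge> 1"
  using supp_nonempty d_dvd supp_pos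
  by (metis One_nat_def Suc_leI dvd_0_left_iff ex_in_conv neq0_conv not_one_le_zero)

text \<open>\<open>Xs\<close> is what remains of the fixed point of size \<open>a + d\<close> after
  the one of size \<open>a\<close> is split off. It commutes with every fixed point, which forces
  each of them to consist of copies of \<open>Xs\<close>.\<close>

theorem common_summand:
  "\<exists>Xs\<in>carrier_mat d d. \<forall>n\<in>nc_supp \<Omega>. Xfix n = dsum_copies z (n div d) Xs"
proof -
  obtain a where a: "a \<in> nc_supp \<Omega>" "a + d \<in> nc_supp \<Omega>"
    using add_closed_consecutive_multiples[of "nc_supp \<Omega>"] supp_add supp_nonempty supp_pos
    unfolding d_def by (metis not_one_le_zero)
  note Xa = Xfix(2)[OF a(1)]
  obtain Xs where Xs: "Xs \<in> carrier_mat d d" "Xfix (a + d) = dsum z (Xfix a) Xs"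
    using dsum_commute_split[OF Xa Xfix(2)[OF a(2)] Xfix_commute[OF a]] by metis
  have "Xfix n = dsum_copies z (n div d) Xs" if n: "n \<in> nc_supp \<Omega>" for n
  proof -
    note Xn = Xfix(2)[OF n]
    \<comment> \<open>Nothing is known yet about moving \<open>Xs\<close> past
      \<open>Xfix n\<close>. Prefixing \<open>Xfix a\<close> turns \<open>Xs\<close> into the fixed
      point of size \<open>a + d\<close>, which does commute with \<open>Xfix n\<close>; the prefix
      is cancelled at the end.\<close>
    have "dsum z (Xfix a) (dsum z (Xfix n) Xs) = dsum z (dsum z (Xfix n) (Xfix a)) Xs"
      using Xfix_commute[OF n a(1)] dsum_assoc[OF Xa Xn Xs(1)] by metis
    also have "\<dots> = dsum z (Xfix n) (Xfix (a + d))"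
      unfolding Xs(2) by (rule dsum_assoc[OF Xn Xa Xs(1)])
    also have "\<dots> = dsum z (dsum z (Xfix a) Xs) (Xfix n)"
      using Xfix_commute[OF n a(2)] Xs(2) by metis
    also have "\<dots> = dsum z (Xfix a) (dsum z Xs (Xfix n))"
      by (rule dsum_assoc[OF Xa Xs(1) Xn])
    finally have "dsum z (Xfix n) Xs = dsum z Xs (Xfix n)"
      by (rule dsum_cancel(2)[OF Xa Xa dsum_carrier[OF Xn Xs(1)], rotated])
        (use dsum_carrier[OF Xs(1) Xn, of z] in \<open>simp add: add.commute\<close>)
    then show ?thesis
      using dsum_commute_imp_copies[OF Xs(1), of "Xfix n" "n div d" z] Xn d_dvd[OF n] by simp
  qed
  then show ?thesis using Xs(1) by blast
qed

end

section \<open>Simultaneous conjugation over a bimodule\<close>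

text \<open>The inverse is carried as a second matrix, matching the two matrices in
  \<open>respects_sim\<close>, so inverses of products and of direct sums can be written down
  explicitly.\<close>

definition inverse_pair :: "nat \<Rightarrow> 'r::unital_ring mat \<Rightarrow> 'r mat \<Rightarrow> bool" where
  "inverse_pair n S T \<longleftrightarrow>
     S \<in> carrier_mat n n \<and> T \<in> carrier_mat n n \<and> S * T = 1\<^sub>m n \<and> T * S = 1\<^sub>m n"

text \<open>The library version \<open>left_mult_one_mat\<close> needs \<^class>\<open>semiring_1\<close>, which excludes the zero ring.\<close>

lemma unital_left_mult_one_mat:
  "A \<in> carrier_mat n m \<Longrightarrow> 1\<^sub>m n * (A :: 'r::unital_ring mat) = A"
  by (rule eq_matI) (auto simp: scalar_prod_def if_distrib[of "\<lambda>x. x * _"] cong: if_cong)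

lemma inverse_pair_one: "inverse_pair n (1\<^sub>m n) (1\<^sub>m n :: 'r::unital_ring mat)"
  unfolding inverse_pair_def using unital_left_mult_one_mat[of "1\<^sub>m n" n n] by simp

lemma inverse_pair_sym: "inverse_pair n S T \<Longrightarrow> inverse_pair n T S"
  unfolding inverse_pair_def by simp

lemma inverse_pair_mult:
  assumes "inverse_pair n S T" "inverse_pair n S' T'"
  shows "inverse_pair n (S * S') (T' * T)"
proof -
  \<comment> \<open>Stated for arbitrary pairs so that exchanging the roles of the matrices also
    gives the product in the opposite order.\<close>
  have *: "(A * A') * (B' * B) = 1\<^sub>m n"
    if "inverse_pair n A B" "inverse_pair n A' B'" for A A' B B' :: "'a mat"
  proof -
    have c: "A \<in> carrier_mat n n" "A' \<in> carrier_mat n n" "B \<in> carrier_mat n n" "B' \<in> carrier_mat n n"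
      and eq: "A * B = 1\<^sub>m n" "A' * B' = 1\<^sub>m n"
      using that unfolding inverse_pair_def by auto
    have "(A * A') * (B' * B) = A * (A' * (B' * B))"
      using c by (intro assoc_mult_mat[of _ n n _ n _ n]) auto
    also have "A' * (B' * B) = (A' * B') * B"
      using c by (intro assoc_mult_mat[of _ n n _ n _ n, symmetric]) auto
    finally show ?thesis using c eq by (simp add: unital_left_mult_one_mat)
  qed
  show ?thesis
    using *[OF assms] *[OF inverse_pair_sym[OF assms(2)] inverse_pair_sym[OF assms(1)]] assms
    unfolding inverse_pair_def by auto
qed

lemma dsum_mult:
  fixes A :: "'r::unital_ring mat"
  assumes "A \<in> carrier_mat n n" "B \<in> carrier_mat n n" "A' \<in> carrier_mat m m" "B' \<in> carrier_mat m m"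
  shows "dsum 0 A A' * dsum 0 B B' = dsum 0 (A * B) (A' * B')"
proof -
  have z: "mat p q (\<lambda>_. 0) = (0\<^sub>m p q :: 'r mat)" for p q by (rule eq_matI) auto
  show ?thesis unfolding dsum_def z using assms
    by (subst mult_four_block_mat[of _ n n _ m _ m _ _ n _ m]) auto
qed

lemma dsum_one: "dsum 0 (1\<^sub>m n) (1\<^sub>m m) = (1\<^sub>m (n + m) :: 'r::unital_ring mat)"
  unfolding dsum_def by (rule eq_matI) auto

lemma inverse_pair_dsum:
  assumes "inverse_pair n S T" "inverse_pair m S' T'"
  shows "inverse_pair (n + m) (dsum 0 S S') (dsum 0 T T')"
  using assms dsum_mult[of S n T S' m T'] dsum_mult[of T n S T' m S']
  unfolding inverse_pair_def by (auto simp: dsum_one)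

text \<open>Used to cut the inner sum of a block product at the block boundary.\<close>

lemma sum_lessThan_add:
  fixes g :: "nat \<Rightarrow> 'b::comm_monoid_add"
  shows "(\<Sum>k<n + m. g k) = (\<Sum>k<n. g k) + (\<Sum>k<m. g (n + k))"
  by (induction m) (auto simp: add.assoc)

section \<open>Scalar actions of a bimodule and the conjugation of matrices they induce\<close>

context bimodule
begin

lemma lscale_zero_right [simp]: "lscale a 0 = 0"
  using lscale_add_right[of a 0 0] by simp

lemma lscale_zero_left [simp]: "lscale 0 x = 0"
  using lscale_add_left[of 0 0 x] by simp

lemma rscale_zero_left [simp]: "rscale 0 a = 0"
  using rscale_add_left[of 0 0 a] by simp

lemma rscale_zero_right [simp]: "rscale x 0 = 0"
  using rscale_add_right[of x 0 0] by simp

lemma lscale_sum_right: "lscale a (sum g A) = (\<Sum>k\<in>A. lscale a (g k))"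
  by (induction A rule: infinite_finite_induct) (auto simp: lscale_add_right)

lemma lscale_sum_left: "lscale (sum g A) x = (\<Sum>k\<in>A. lscale (g k) x)"
  by (induction A rule: infinite_finite_induct) (auto simp: lscale_add_left)

lemma rscale_sum_left: "rscale (sum g A) a = (\<Sum>k\<in>A. rscale (g k) a)"
  by (induction A rule: infinite_finite_induct) (auto simp: rscale_add_left)

lemma rscale_sum_right: "rscale x (sum g A) = (\<Sum>k\<in>A. rscale x (g k))"
  by (induction A rule: infinite_finite_induct) (auto simp: rscale_add_right)

abbreviation lm :: "'r mat \<Rightarrow> 'm mat \<Rightarrow> 'm mat" where
  "lm \<equiv> lmult_mat lscale"

abbreviation rm :: "'m mat \<Rightarrow> 'r mat \<Rightarrow> 'm mat" where
  "rm \<equiv> rmult_mat rscale"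

text \<open>\<open>T\<close> stands in for the inverse of \<open>S\<close> without being tied to it,
  so the composition and block laws hold for arbitrary square matrices.\<close>

definition conj_mat :: "'r mat \<Rightarrow> 'r mat \<Rightarrow> 'm mat \<Rightarrow> 'm mat" where
  "conj_mat S T X = rm (lm S X) T"

lemma lm_carrier [simp]: "S \<in> carrier_mat n k \<Longrightarrow> X \<in> carrier_mat k m \<Longrightarrow> lm S X \<in> carrier_mat n m"
  unfolding lmult_mat_def by auto

lemma rm_carrier [simp]: "X \<in> carrier_mat n k \<Longrightarrow> S \<in> carrier_mat k m \<Longrightarrow> rm X S \<in> carrier_mat n m"
  unfolding rmult_mat_def by auto

lemma conj_mat_carrier [simp]:
  "S \<in> carrier_mat n n \<Longrightarrow> T \<in> carrier_mat n n \<Longrightarrow> X \<in> carrier_mat n n \<Longrightarrow>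
   conj_mat S T X \<in> carrier_mat n n"
  unfolding conj_mat_def by (meson lm_carrier rm_carrier)

lemma lm_lm:
  assumes "S \<in> carrier_mat n n" "S' \<in> carrier_mat n n" "X \<in> carrier_mat n n"
  shows "lm S (lm S' X) = lm (S * S') X"
proof (rule eq_matI)
  fix i j assume "i < dim_row (lm (S * S') X)" "j < dim_col (lm (S * S') X)"
  then have ij: "i < n" "j < n" using assms by (auto simp: lmult_mat_def)
  have "lm S (lm S' X) $$ (i, j) = (\<Sum>k<n. \<Sum>l<n. lscale (S $$ (i, k) * S' $$ (k, l)) (X $$ (l, j)))"
    using assms ij by (auto simp: lmult_mat_def lscale_sum_right lscale_lscale)
  also have "\<dots> = (\<Sum>l<n. \<Sum>k<n. lscale (S $$ (i, k) * S' $$ (k, l)) (X $$ (l, j)))"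
    by (rule sum.swap)
  also have "\<dots> = lm (S * S') X $$ (i, j)"
    using assms ij
    by (auto simp: lmult_mat_def scalar_prod_def lscale_sum_left lessThan_atLeast0 intro!: sum.cong)
  finally show "lm S (lm S' X) $$ (i, j) = lm (S * S') X $$ (i, j)" .
qed (use assms in \<open>auto simp: lmult_mat_def\<close>)

lemma rm_rm:
  assumes "T \<in> carrier_mat n n" "T' \<in> carrier_mat n n" "X \<in> carrier_mat n n"
  shows "rm (rm X T') T = rm X (T' * T)"
proof (rule eq_matI)
  fix i j assume "i < dim_row (rm X (T' * T))" "j < dim_col (rm X (T' * T))"
  then have ij: "i < n" "j < n" using assms by (auto simp: rmult_mat_def)
  have "rm (rm X T') T $$ (i, j) = (\<Sum>k<n. \<Sum>l<n. rscale (X $$ (i, l)) (T' $$ (l, k) * T $$ (k, j)))"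
    using assms ij by (auto simp: rmult_mat_def rscale_sum_left rscale_rscale)
  also have "\<dots> = (\<Sum>l<n. \<Sum>k<n. rscale (X $$ (i, l)) (T' $$ (l, k) * T $$ (k, j)))"
    by (rule sum.swap)
  also have "\<dots> = rm X (T' * T) $$ (i, j)"
    using assms ij
    by (auto simp: rmult_mat_def scalar_prod_def rscale_sum_right lessThan_atLeast0 intro!: sum.cong)
  finally show "rm (rm X T') T $$ (i, j) = rm X (T' * T) $$ (i, j)" .
qed (use assms in \<open>auto simp: rmult_mat_def\<close>)

text \<open>Interchanging the two sums reduces this to \<open>lscale_rscale\<close>; it is what
  allows nested conjugations to be regrouped.\<close>

lemma lm_rm:
  assumes "S \<in> carrier_mat n n" "T \<in> carrier_mat n n" "X \<in> carrier_mat n n"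
  shows "lm S (rm X T) = rm (lm S X) T"
proof (rule eq_matI)
  fix i j assume "i < dim_row (rm (lm S X) T)" "j < dim_col (rm (lm S X) T)"
  then have ij: "i < n" "j < n" using assms by (auto simp: rmult_mat_def lmult_mat_def)
  have "lm S (rm X T) $$ (i, j) = (\<Sum>k<n. \<Sum>l<n. lscale (S $$ (i, k)) (rscale (X $$ (k, l)) (T $$ (l, j))))"
    using assms ij by (auto simp: rmult_mat_def lmult_mat_def lscale_sum_right)
  also have "\<dots> = (\<Sum>l<n. \<Sum>k<n. lscale (S $$ (i, k)) (rscale (X $$ (k, l)) (T $$ (l, j))))"
    by (rule sum.swap)
  also have "\<dots> = rm (lm S X) T $$ (i, j)"
    using assms ij by (auto simp: rmult_mat_def lmult_mat_def rscale_sum_left lscale_rscale)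
  finally show "lm S (rm X T) $$ (i, j) = rm (lm S X) T $$ (i, j)" .
qed (use assms in \<open>auto simp: rmult_mat_def lmult_mat_def\<close>)

text \<open>Right factors compose in the reverse order, in agreement with
  \<open>inverse_pair_mult\<close>.\<close>

lemma conj_mat_mult:
  assumes "S \<in> carrier_mat n n" "T \<in> carrier_mat n n" "S' \<in> carrier_mat n n" "T' \<in> carrier_mat n n"
    "X \<in> carrier_mat n n"
  shows "conj_mat S T (conj_mat S' T' X) = conj_mat (S * S') (T' * T) X"
proof -
  have "lm S (rm (lm S' X) T') = rm (lm (S * S') X) T'"
    using assms by (simp add: lm_rm[of _ n] lm_lm[of _ n])
  then show ?thesis
    unfolding conj_mat_def using assms rm_rm[of T n T' "lm (S * S') X"]
    by (metis lm_carrier mult_carrier_mat)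
qed

lemma conj_mat_one:
  assumes "X \<in> carrier_mat n n"
  shows "conj_mat (1\<^sub>m n) (1\<^sub>m n) X = X"
proof -
  have "lm (1\<^sub>m n) X = X"
    by (rule eq_matI)
      (use assms in \<open>auto simp: lmult_mat_def lscale_one if_distrib[of "\<lambda>s. lscale s _"] cong: if_cong\<close>)
  moreover have "rm X (1\<^sub>m n) = X"
    by (rule eq_matI)
      (use assms in \<open>auto simp: rmult_mat_def rscale_one if_distrib[of "rscale _"] cong: if_cong\<close>)
  ultimately show ?thesis unfolding conj_mat_def by simp
qed

lemma conj_mat_inverse:
  assumes "inverse_pair n S T" "X \<in> carrier_mat n n"
  shows "conj_mat T S (conj_mat S T X) = X"
  using assms unfolding inverse_pair_def by (simp add: conj_mat_mult[of _ n] conj_mat_one)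

text \<open>Cut at the block boundary, the inner sum keeps only terms within one diagonal block;
  every other term contains a zero scalar or a zero module element.\<close>

lemma lm_dsum:
  assumes "S \<in> carrier_mat n n" "S' \<in> carrier_mat m m" "X \<in> carrier_mat n n" "X' \<in> carrier_mat m m"
  shows "lm (dsum 0 S S') (dsum 0 X X') = dsum 0 (lm S X) (lm S' X')"
proof (rule eq_matI)
  note R = dsum_carrier[OF lm_carrier[OF assms(1,3)] lm_carrier[OF assms(2,4)], of 0]
  note DS = dsum_carrier[OF assms(1,2), of 0] and DX = dsum_carrier[OF assms(3,4), of 0]
  fix i j assume "i < dim_row (dsum 0 (lm S X) (lm S' X'))" "j < dim_col (dsum 0 (lm S X) (lm S' X'))"
  then have ij: "i < n + m" "j < n + m" using R by auto
  have "lm (dsum 0 S S') (dsum 0 X X') $$ (i, j) =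
      (\<Sum>k<n + m. lscale (dsum 0 S S' $$ (i, k)) (dsum 0 X X' $$ (k, j)))"
    using DS DX ij by (auto simp: lmult_mat_def)
  also have "\<dots> = dsum 0 (lm S X) (lm S' X') $$ (i, j)"
    using ij assms unfolding sum_lessThan_add
      dsum_index[OF lm_carrier[OF assms(1,3)] lm_carrier[OF assms(2,4)] ij]
    by (cases "i < n"; cases "j < n")
      (auto simp: dsum_index[OF assms(1,2)] dsum_index[OF assms(3,4)] lmult_mat_def)
  finally show "lm (dsum 0 S S') (dsum 0 X X') $$ (i, j) = dsum 0 (lm S X) (lm S' X') $$ (i, j)" .
qed (use assms in \<open>auto simp: lmult_mat_def dsum_def\<close>)

lemma rm_dsum:
  assumes "X \<in> carrier_mat n n" "X' \<in> carrier_mat m m" "S \<in> carrier_mat n n" "S' \<in> carrier_mat m m"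
  shows "rm (dsum 0 X X') (dsum 0 S S') = dsum 0 (rm X S) (rm X' S')"
proof (rule eq_matI)
  note R = dsum_carrier[OF rm_carrier[OF assms(1,3)] rm_carrier[OF assms(2,4)], of 0]
  note DX = dsum_carrier[OF assms(1,2), of 0] and DS = dsum_carrier[OF assms(3,4), of 0]
  fix i j assume "i < dim_row (dsum 0 (rm X S) (rm X' S'))" "j < dim_col (dsum 0 (rm X S) (rm X' S'))"
  then have ij: "i < n + m" "j < n + m" using R by auto
  have "rm (dsum 0 X X') (dsum 0 S S') $$ (i, j) =
      (\<Sum>k<n + m. rscale (dsum 0 X X' $$ (i, k)) (dsum 0 S S' $$ (k, j)))"
    using DS DX ij by (auto simp: rmult_mat_def)
  also have "\<dots> = dsum 0 (rm X S) (rm X' S') $$ (i, j)"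
    using ij assms unfolding sum_lessThan_add
      dsum_index[OF rm_carrier[OF assms(1,3)] rm_carrier[OF assms(2,4)] ij]
    by (cases "i < n"; cases "j < n")
      (auto simp: dsum_index[OF assms(1,2)] dsum_index[OF assms(3,4)] rmult_mat_def)
  finally show "rm (dsum 0 X X') (dsum 0 S S') $$ (i, j) = dsum 0 (rm X S) (rm X' S') $$ (i, j)" .
qed (use assms in \<open>auto simp: rmult_mat_def dsum_def\<close>)

lemma conj_mat_dsum:
  assumes "S \<in> carrier_mat n n" "S' \<in> carrier_mat m m" "T \<in> carrier_mat n n" "T' \<in> carrier_mat m m"
    "X \<in> carrier_mat n n" "X' \<in> carrier_mat m m"
  shows "conj_mat (dsum 0 S S') (dsum 0 T T') (dsum 0 X X') = dsum 0 (conj_mat S T X) (conj_mat S' T' X')"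
  unfolding conj_mat_def using assms
  by (simp add: lm_dsum[of _ n _ m] rm_dsum[of _ n _ m])

text \<open>\<open>P\<close> and \<open>Q\<close> are permutation matrices depending only on the
  block sizes. This uniformity in \<open>A\<close> and \<open>B\<close> lets a matrix and its image
  be rearranged by one and the same similarity.\<close>

lemma dsum_swap:
  obtains P Q :: "'r mat" where "inverse_pair (n + m) P Q"
    "\<And>A B. A \<in> carrier_mat n n \<Longrightarrow> B \<in> carrier_mat m m \<Longrightarrow>
       conj_mat P Q (dsum 0 A B) = dsum 0 B A"
proof -
  define p where "p i = (if i < m then n + i else i - m)" for i
  define P :: "'r mat" where "P = mat (n + m) (n + m) (\<lambda>(i, j). if j = p i then 1 else 0)"
  define Q :: "'r mat" where "Q = mat (n + m) (n + m) (\<lambda>(i, j). if i = p j then 1 else 0)"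
  \<comment> \<open>\<open>q\<close> is the inverse permutation of \<open>p\<close> on the indices
    below \<open>n + m\<close>.\<close>
  define q where "q i = (if i < n then m + i else i - n)" for i
  have pq: "i = p j \<longleftrightarrow> j = q i" if "i < n + m" "j < n + m" for i j
    using that unfolding p_def q_def by auto
  have p: "p i < n + m" and q: "q i < n + m" if "i < n + m" for i
    using that unfolding p_def q_def by auto
  have PQ: "P \<in> carrier_mat (n + m) (n + m)" "Q \<in> carrier_mat (n + m) (n + m)"
    unfolding P_def Q_def by auto
  have inj: "p i = p j \<longleftrightarrow> i = j" "q i = q j \<longleftrightarrow> i = j" if "i < n + m" "j < n + m" for i j
    using that unfolding p_def q_def by auto
  have "P * Q = 1\<^sub>m (n + m)"
    by (rule eq_matI) (auto simp: P_def Q_def scalar_prod_def p inj if_distrib[of "\<lambda>x. x * _"] cong: if_cong)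
  \<comment> \<open>Over a general ring a one-sided inverse need not be two-sided, so this product
    is computed separately. The nonzero terms are given by \<open>i = p k\<close>, which
    \<open>q\<close> solves for \<open>k\<close>.\<close>
  moreover have "Q * P = 1\<^sub>m (n + m)"
  proof (rule eq_matI)
    fix i j assume "i < dim_row (1\<^sub>m (n + m) :: 'r mat)" "j < dim_col (1\<^sub>m (n + m) :: 'r mat)"
    then have ij: "i < n + m" "j < n + m" by auto
    then have "(Q * P) $$ (i, j) = (\<Sum>k = 0..<n + m. (if i = p k then 1 else 0) * (if j = p k then 1 else 0))"
      by (auto simp: P_def Q_def scalar_prod_def)
    also have "\<dots> = (\<Sum>k = 0..<n + m. if k = q i then (if k = q j then 1 else 0) else 0)"
      using ij by (intro sum.cong) (auto simp: pq)
    also have "\<dots> = (1\<^sub>m (n + m) :: 'r mat) $$ (i, j)"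
      using ij by (auto simp: q inj)
    finally show "(Q * P) $$ (i, j) = (1\<^sub>m (n + m) :: 'r mat) $$ (i, j)" .
  qed (use PQ in auto)
  ultimately have inv: "inverse_pair (n + m) P Q" using PQ unfolding inverse_pair_def by blast
  have "conj_mat P Q (dsum 0 A B) = dsum 0 B A"
    if A: "A \<in> carrier_mat n n" and B: "B \<in> carrier_mat m m" for A B
  proof (rule eq_matI)
    fix i j assume "i < dim_row (dsum 0 B A)" "j < dim_col (dsum 0 B A)"
    then have ij: "i < n + m" "j < n + m" using dsum_carrier[OF B A, of 0] by auto
    note X = dsum_carrier[OF A B, of 0]
    \<comment> \<open>Row \<open>i\<close> of \<open>P\<close> has its only 1 in column
      \<open>p i\<close>, so it selects row \<open>p i\<close>.\<close>
    have L: "lm P (dsum 0 A B) $$ (i, k) = dsum 0 A B $$ (p i, k)" if "k < n + m" for k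
      using X ij that p[of i]
      by (auto simp: lmult_mat_def P_def lscale_one if_distrib[of "\<lambda>s. lscale s _"] cong: if_cong)
    have "conj_mat P Q (dsum 0 A B) $$ (i, j) =
        (\<Sum>k<n + m. rscale (lm P (dsum 0 A B) $$ (i, k)) (Q $$ (k, j)))"
      using lm_carrier[OF PQ(1) X] PQ ij by (auto simp: conj_mat_def rmult_mat_def)
    also have "\<dots> = (\<Sum>k<n + m. if k = p j then dsum 0 A B $$ (p i, k) else 0)"
      using ij by (intro sum.cong) (auto simp: L Q_def rscale_one)
    also have "\<dots> = dsum 0 A B $$ (p i, p j)" using p[OF ij(2)] by simp
    also have "\<dots> = dsum 0 B A $$ (i, j)"
      unfolding dsum_index[OF A B p[OF ij(1)] p[OF ij(2)]]
      using ij dsum_index[OF B A, of i j 0] by (auto simp: p_def)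
    finally show "conj_mat P Q (dsum 0 A B) $$ (i, j) = dsum 0 B A $$ (i, j)" .
  qed (use conj_mat_carrier[OF PQ dsum_carrier[OF A B, of 0]] dsum_carrier[OF B A, of 0] in auto)
  then show thesis using that inv by blast
qed

end

section \<open>Extension by the common summand\<close>

locale nc_fixpoints = dsum_fixpoints 0 \<Omega> f Xfix d + bimodule lscale rscale
  for \<Omega> :: "'m::ab_group_add mat set" and f Xfix d
    and lscale :: "'r::unital_ring \<Rightarrow> 'm \<Rightarrow> 'm" and rscale +
  fixes Xs :: "'m mat"
  assumes sim: "respects_sim lscale rscale lscale rscale \<Omega> f"
    and Xs_carrier: "Xs \<in> carrier_mat d d"
    and Xfix_copies: "\<forall>n\<in>nc_supp \<Omega>. Xfix n = dsum_copies 0 (n div d) Xs"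
begin

abbreviation Xpow :: "nat \<Rightarrow> 'm mat" where
  "Xpow k \<equiv> dsum_copies 0 k Xs"

lemma Xpow_carrier: "Xpow k \<in> carrier_mat (k * d) (k * d)"
  using Xs_carrier by simp

lemma Xpow_fixed:
  assumes "k * d \<in> nc_supp \<Omega>"
  shows "Xpow k \<in> \<Omega>" "f (Xpow k) = Xpow k"
  using Xfix[OF assms] Xfix_copies assms d_pos by auto

lemma f_conj_mat:
  assumes "inverse_pair n S T" "X \<in> \<Omega>" "X \<in> carrier_mat n n" "conj_mat S T X \<in> \<Omega>"
  shows "f (conj_mat S T X) = conj_mat S T (f X)"
proof -
  have ST: "S \<in> carrier_mat n n" "T \<in> carrier_mat n n" "S * T = 1\<^sub>m n" "T * S = 1\<^sub>m n"
    using assms(1) unfolding inverse_pair_def by auto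
  have X: "X \<in> level \<Omega> n" and SX: "rm (lm S X) T \<in> level \<Omega> n"
    using assms conj_mat_carrier[OF ST(1,2) assms(3)] unfolding conj_mat_def mem_level by auto
  show ?thesis
    using sim[unfolded respects_sim_def, rule_format, OF X ST SX] unfolding conj_mat_def .
qed

text \<open>The graph of \<open>f'\<close>; that it is single-valued is \<open>ext_unique\<close>.\<close>

inductive ext :: "'m mat \<Rightarrow> 'm mat \<Rightarrow> bool" where
  base: "X \<in> \<Omega> \<Longrightarrow> ext X (f X)"
| point: "ext Xs Xs"
| dsum: "ext Z W \<Longrightarrow> ext Z' W' \<Longrightarrow> ext (dsum 0 Z Z') (dsum 0 W W')"

lemma ext_carrier:
  "ext Z W \<Longrightarrow> \<exists>k\<ge>1. Z \<in> carrier_mat (k * d) (k * d) \<and> W \<in> carrier_mat (k * d) (k * d)"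
proof (induction rule: ext.induct)
  case (base X)
  then obtain n where n: "n \<in> nc_supp \<Omega>" "X \<in> carrier_mat n n" "f X \<in> carrier_mat n n"
    using mem_cases by blast
  then have "n = (n div d) * d" "n div d \<ge> 1" using d_dvd[of n] supp_pos[of n] by (auto elim: dvdE)
  then show ?case using n by metis
next
  case point
  then show ?case using Xs_carrier by (intro exI[of _ 1]) simp
next
  case (dsum Z W Z' W')
  then obtain k l where "k \<ge> 1" "Z \<in> carrier_mat (k * d) (k * d)" "W \<in> carrier_mat (k * d) (k * d)"
    "Z' \<in> carrier_mat (l * d) (l * d)" "W' \<in> carrier_mat (l * d) (l * d)" by blast
  then show ?case by (intro exI[of _ "k + l"]) (auto simp: add_mult_distrib)
qed

text \<open>The image of a generator is a generator: \<open>f X\<close> stays in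
  \<open>\<Omega>\<close> and \<open>Xs\<close> is kept.\<close>

lemma ext_closed: "ext Z W \<Longrightarrow> \<exists>V. ext W V"
  by (induction rule: ext.induct) (use ext.intros mem_cases in metis)+

lemma ext_Xpow: "k \<ge> 1 \<Longrightarrow> ext (Xpow k) (Xpow k)"
proof (induction k rule: dec_induct)
  case base
  then show ?case using ext.point by simp
next
  case (step k)
  then show ?case using ext.dsum[OF ext.point] by simp
qed

text \<open>Summands and their images have equal sizes, so a fixed sum has fixed summands. This
  descends to \<open>\<Omega>\<close>, where uniqueness gives \<open>Xfix n\<close>, a sum of copies
  of \<open>Xs\<close>. Keeping \<open>Z = W\<close> as a separate premise lets the rule induction
  run on general pairs.\<close>

lemma ext_fixed: "ext Z W \<Longrightarrow> Z = W \<Longrightarrow> \<exists>k. Z = Xpow k"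
proof (induction rule: ext.induct)
  case (base X)
  then obtain n where n: "n \<in> nc_supp \<Omega>" "X \<in> carrier_mat n n" using mem_cases by metis
  then have "X = Xfix n" using Xfix_unique base by metis
  then show ?case using n Xfix_copies by auto
next
  case point
  show ?case by (intro exI[of _ 1]) simp
next
  case (dsum Z W Z' W')
  obtain k l where c: "Z \<in> carrier_mat k k" "W \<in> carrier_mat k k"
    "Z' \<in> carrier_mat l l" "W' \<in> carrier_mat l l" using ext_carrier dsum.hyps by metis
  then have "Z = W" "Z' = W'" using dsum_cancel[OF c] dsum.prems by auto
  then show ?case using dsum.IH dsum_copies_add[OF Xs_carrier] by metis
qed

text \<open>Enough added copies of \<open>Xs\<close> bring \<open>Z\<close> into
  \<open>\<Omega>\<close> up to similarity, and the same \<open>S\<close> and \<open>T\<close> serve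
  its image \<open>W\<close>. Having this for all large \<open>N\<close> allows a common
  \<open>N\<close> to be chosen for two matrices.\<close>

lemma ext_stable:
  "ext Z W \<Longrightarrow> \<exists>N0. \<forall>N\<ge>N0. \<exists>n S T Y. inverse_pair n S T \<and> Y \<in> \<Omega> \<and> Y \<in> carrier_mat n n \<and>
     conj_mat S T Y = dsum 0 Z (Xpow N) \<and> conj_mat S T (f Y) = dsum 0 W (Xpow N)"
proof (induction rule: ext.induct)
  case (base X)
  obtain N0 where N0: "\<And>N. N \<ge> N0 \<Longrightarrow> N * d \<in> nc_supp \<Omega>" using supp_eventually by blast
  have "\<exists>n S T Y. inverse_pair n S T \<and> Y \<in> \<Omega> \<and> Y \<in> carrier_mat n n \<and>
     conj_mat S T Y = dsum 0 X (Xpow N) \<and> conj_mat S T (f Y) = dsum 0 (f X) (Xpow N)" if "N \<ge> N0" for N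
  proof -
    note Xp = Xpow_fixed[OF N0[OF that]]
    \<comment> \<open>The padding is itself a fixed point in \<open>\<Omega>\<close>, so the
      identity similarity suffices.\<close>
    have Y: "dsum 0 X (Xpow N) \<in> \<Omega>" "f (dsum 0 X (Xpow N)) = dsum 0 (f X) (Xpow N)"
      using base Xp dsum_mem f_dsum by auto
    then obtain n where "dsum 0 X (Xpow N) \<in> carrier_mat n n" "dsum 0 (f X) (Xpow N) \<in> carrier_mat n n"
      using mem_cases by metis
    then show ?thesis using Y
      by (intro exI[of _ n] exI[of _ "1\<^sub>m n"] exI[of _ "dsum 0 X (Xpow N)"])
        (simp add: inverse_pair_one conj_mat_one)
  qed
  then show ?case by blast
next
  case point
  obtain N0 where N0: "\<And>N. N \<ge> N0 \<Longrightarrow> N * d \<in> nc_supp \<Omega>" using supp_eventually by blast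
  have "\<exists>n S T Y. inverse_pair n S T \<and> Y \<in> \<Omega> \<and> Y \<in> carrier_mat n n \<and>
     conj_mat S T Y = dsum 0 Xs (Xpow N) \<and> conj_mat S T (f Y) = dsum 0 Xs (Xpow N)" if "N \<ge> N0" for N
  proof -
    \<comment> \<open>Here \<open>Xs\<close> counts as one more copy, and the whole sum is a fixed
      point of \<open>f\<close>.\<close>
    have "Suc N * d \<in> nc_supp \<Omega>" using N0 that le_SucI by blast
    note Xp = Xpow_fixed[OF this] Xpow_carrier[of "Suc N"]
    then show ?thesis unfolding dsum_copies.simps(2)[symmetric]
      by (intro exI[of _ "Suc N * d"] exI[of _ "1\<^sub>m (Suc N * d)"] exI[of _ "Xpow (Suc N)"])
        (simp add: inverse_pair_one conj_mat_one del: dsum_copies.simps(2) mult_Suc)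
  qed
  then show ?case by blast
next
  case (dsum Z W Z' W')
  obtain k l where Z: "Z \<in> carrier_mat k k" and W: "W \<in> carrier_mat k k"
    and Z': "Z' \<in> carrier_mat l l" and W': "W' \<in> carrier_mat l l"
    using ext_carrier dsum.hyps by metis
  obtain M where M: "\<And>N. N \<ge> M \<Longrightarrow> \<exists>n S T Y. inverse_pair n S T \<and> Y \<in> \<Omega> \<and> Y \<in> carrier_mat n n \<and>
     conj_mat S T Y = dsum 0 Z (Xpow N) \<and> conj_mat S T (f Y) = dsum 0 W (Xpow N)"
    using dsum.IH(1) by blast
  obtain M' where M': "\<And>N. N \<ge> M' \<Longrightarrow> \<exists>n S T Y. inverse_pair n S T \<and> Y \<in> \<Omega> \<and> Y \<in> carrier_mat n n \<and>
     conj_mat S T Y = dsum 0 Z' (Xpow N) \<and> conj_mat S T (f Y) = dsum 0 W' (Xpow N)"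
    using dsum.IH(2) by blast
  have "\<exists>n S T Y. inverse_pair n S T \<and> Y \<in> \<Omega> \<and> Y \<in> carrier_mat n n \<and>
     conj_mat S T Y = dsum 0 (dsum 0 Z Z') (Xpow N) \<and> conj_mat S T (f Y) = dsum 0 (dsum 0 W W') (Xpow N)"
    if N: "N \<ge> M + M'" for N
  proof -
    \<comment> \<open>The \<open>N\<close> copies are shared out: \<open>M\<close> go to the first
      summand and \<open>K\<close> to the second.\<close>
    define K where "K = N - M"
    have K: "N = M + K" "K \<ge> M'" using N unfolding K_def by auto
    obtain n S T Y where Y: "inverse_pair n S T" "Y \<in> \<Omega>" "Y \<in> carrier_mat n n"
      "conj_mat S T Y = dsum 0 Z (Xpow M)" "conj_mat S T (f Y) = dsum 0 W (Xpow M)"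
      using M[of M] by blast
    obtain n' S' T' Y' where Y': "inverse_pair n' S' T'" "Y' \<in> \<Omega>" "Y' \<in> carrier_mat n' n'"
      "conj_mat S' T' Y' = dsum 0 Z' (Xpow K)" "conj_mat S' T' (f Y') = dsum 0 W' (Xpow K)"
      using M'[OF K(2)] by blast
    have fY: "f Y \<in> carrier_mat n n" and fY': "f Y' \<in> carrier_mat n' n'"
      using Y(2,3) Y'(2,3) mem_cases by (metis carrier_matD(1))+
    note XM = Xpow_carrier[of M] and XK = Xpow_carrier[of K]
    obtain P Q where P: "inverse_pair (M * d + l) P Q"
      "\<And>A B. A \<in> carrier_mat (M * d) (M * d) \<Longrightarrow> B \<in> carrier_mat l l \<Longrightarrow>
         conj_mat P Q (dsum 0 A B) = dsum 0 B A"
      using dsum_swap by blast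
    have carr: "S \<in> carrier_mat n n" "T \<in> carrier_mat n n" "S' \<in> carrier_mat n' n'" "T' \<in> carrier_mat n' n'"
      "P \<in> carrier_mat (M * d + l) (M * d + l)" "Q \<in> carrier_mat (M * d + l) (M * d + l)"
      using Y(1) Y'(1) P(1) unfolding inverse_pair_def by auto
    have "conj_mat S T Y \<in> carrier_mat n n" "conj_mat S' T' Y' \<in> carrier_mat n' n'"
      using carr Y(3) Y'(3) by simp_all
    then have nn: "n = k + M * d" "n' = l + K * d"
      using dsum_carrier[OF Z XM, of 0] dsum_carrier[OF Z' XK, of 0] unfolding Y(4) Y'(4) by auto
    \<comment> \<open>This similarity exchanges the two middle blocks and leaves the first block and
      the last \<open>K\<close> copies alone.\<close>
    define U V where "U = dsum 0 (1\<^sub>m k) (dsum 0 P (1\<^sub>m (K * d)))"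
      and "V = dsum 0 (1\<^sub>m k) (dsum 0 Q (1\<^sub>m (K * d)))"
    have dims: "k + ((M * d + l) + K * d) = n + n'" using nn by simp
    have UV: "inverse_pair (n + n') U V"
      unfolding U_def V_def dims[symmetric]
      by (intro inverse_pair_dsum inverse_pair_one P(1))
    \<comment> \<open>The \<open>M\<close> copies move past \<open>B\<close> to join the other
      \<open>K\<close>. Arbitrary \<open>A\<close> and \<open>B\<close> are allowed because this
      serves both \<open>Z\<close>, \<open>Z'\<close> and \<open>W\<close>,
      \<open>W'\<close>.\<close>
    have swap: "conj_mat U V (dsum 0 (dsum 0 A (Xpow M)) (dsum 0 B (Xpow K))) =
        dsum 0 (dsum 0 A B) (Xpow N)"
      if A: "A \<in> carrier_mat k k" and B: "B \<in> carrier_mat l l" for A B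
    proof -
      have "dsum 0 (dsum 0 A (Xpow M)) (dsum 0 B (Xpow K)) =
          dsum 0 A (dsum 0 (dsum 0 (Xpow M) B) (Xpow K))"
        using dsum_assoc[OF A XM dsum_carrier[OF B XK]] dsum_assoc[OF XM B XK] by metis
      moreover have "conj_mat U V (dsum 0 A (dsum 0 (dsum 0 (Xpow M) B) (Xpow K))) =
          dsum 0 (conj_mat (1\<^sub>m k) (1\<^sub>m k) A) (dsum 0 (conj_mat P Q (dsum 0 (Xpow M) B))
            (conj_mat (1\<^sub>m (K * d)) (1\<^sub>m (K * d)) (Xpow K)))"
        unfolding U_def V_def
        by (subst conj_mat_dsum[OF one_carrier_mat dsum_carrier[OF carr(5) one_carrier_mat]
                one_carrier_mat dsum_carrier[OF carr(6) one_carrier_mat] A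
                dsum_carrier[OF dsum_carrier[OF XM B] XK]],
            subst conj_mat_dsum[OF carr(5) one_carrier_mat carr(6) one_carrier_mat
                dsum_carrier[OF XM B] XK]) (rule refl)
      moreover have "\<dots> = dsum 0 A (dsum 0 (dsum 0 B (Xpow M)) (Xpow K))"
        using A B XM XK by (simp add: conj_mat_one P(2))
      moreover have "\<dots> = dsum 0 (dsum 0 A B) (Xpow N)"
        unfolding K(1) dsum_copies_add[OF Xs_carrier]
        using dsum_assoc[OF B XM XK] dsum_assoc[OF A B dsum_carrier[OF XM XK]] by metis
      ultimately show ?thesis by simp
    qed
    let ?S = "U * dsum 0 S S'" and ?T = "dsum 0 T T' * V"
    have inv: "inverse_pair (n + n') ?S ?T"
      by (rule inverse_pair_mult[OF UV inverse_pair_dsum[OF Y(1) Y'(1)]])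
    have conj: "conj_mat ?S ?T (dsum 0 A B) = conj_mat U V (dsum 0 (conj_mat S T A) (conj_mat S' T' B))"
      if "A \<in> carrier_mat n n" "B \<in> carrier_mat n' n'" for A B
      using that carr UV unfolding inverse_pair_def
      by (simp add: conj_mat_mult[of _ "n + n'", symmetric] conj_mat_dsum[of _ n _ n'])
    have "dsum 0 Y Y' \<in> \<Omega>" "dsum 0 Y Y' \<in> carrier_mat (n + n') (n + n')"
      "f (dsum 0 Y Y') = dsum 0 (f Y) (f Y')"
      using Y(2,3) Y'(2,3) dsum_mem f_dsum by auto
    moreover have "conj_mat ?S ?T (dsum 0 Y Y') = dsum 0 (dsum 0 Z Z') (Xpow N)"
      using conj[OF Y(3) Y'(3)] swap[OF Z Z'] Y(4) Y'(4) by simp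
    moreover have "conj_mat ?S ?T (dsum 0 (f Y) (f Y')) = dsum 0 (dsum 0 W W') (Xpow N)"
      using conj[OF fY fY'] swap[OF W W'] Y(5) Y'(5) by simp
    ultimately show ?thesis using inv
      by (intro exI[of _ "n + n'"] exI[of _ ?S] exI[of _ ?T] exI[of _ "dsum 0 Y Y'"]) simp
  qed
  then show ?case by blast
qed

text \<open>After padding, \<open>Z\<close> and its conjugate are similar to \<open>Y\<close> and
  \<open>Y'\<close> in \<open>\<Omega>\<close>. The similarity of \<open>f\<close> on
  \<open>\<Omega>\<close> is then transported back to the padded images, and the padding is
  cancelled.\<close>

lemma ext_conj_mat:
  assumes ZW: "ext Z W" and ZW': "ext (conj_mat S T Z) W'"
    and ST: "inverse_pair n S T" and Z: "Z \<in> carrier_mat n n"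
  shows "W' = conj_mat S T W"
proof -
  have ST': "S \<in> carrier_mat n n" "T \<in> carrier_mat n n" using ST unfolding inverse_pair_def by auto
  have W: "W \<in> carrier_mat n n" using ext_carrier[OF ZW] Z by (metis carrier_matD(1))
  have W': "W' \<in> carrier_mat n n"
    using ext_carrier[OF ZW'] conj_mat_carrier[OF ST' Z] by (metis carrier_matD(1))
  obtain M where M: "\<And>N. N \<ge> M \<Longrightarrow> \<exists>n S T Y. inverse_pair n S T \<and> Y \<in> \<Omega> \<and> Y \<in> carrier_mat n n \<and>
     conj_mat S T Y = dsum 0 Z (Xpow N) \<and> conj_mat S T (f Y) = dsum 0 W (Xpow N)"
    using ext_stable[OF ZW] by blast
  obtain M' where M': "\<And>N. N \<ge> M' \<Longrightarrow> \<exists>n A B Y. inverse_pair n A B \<and> Y \<in> \<Omega> \<and> Y \<in> carrier_mat n n \<and>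
     conj_mat A B Y = dsum 0 (conj_mat S T Z) (Xpow N) \<and> conj_mat A B (f Y) = dsum 0 W' (Xpow N)"
    using ext_stable[OF ZW'] by blast
  define N where "N = max M M'"
  note XN = Xpow_carrier[of N]
  define p where "p = n + N * d"
  note ZN = dsum_carrier[OF Z XN, of 0, folded p_def]
  note ZN' = dsum_carrier[OF conj_mat_carrier[OF ST' Z] XN, of 0, folded p_def]
  obtain n1 S1 T1 Y where "inverse_pair n1 S1 T1" "Y \<in> carrier_mat n1 n1"
    and Y: "Y \<in> \<Omega>" "conj_mat S1 T1 Y = dsum 0 Z (Xpow N)" "conj_mat S1 T1 (f Y) = dsum 0 W (Xpow N)"
    using M[of N] unfolding N_def by auto
  moreover have "n1 = p" using conj_mat_carrier[of S1 n1 T1 Y] calculation ZN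
    unfolding inverse_pair_def by (metis carrier_matD(1))
  ultimately have i1: "inverse_pair p S1 T1" and Yc: "Y \<in> carrier_mat p p" by auto
  obtain n2 S2 T2 Y' where "inverse_pair n2 S2 T2" "Y' \<in> carrier_mat n2 n2"
    and Y': "Y' \<in> \<Omega>" "conj_mat S2 T2 Y' = dsum 0 (conj_mat S T Z) (Xpow N)"
      "conj_mat S2 T2 (f Y') = dsum 0 W' (Xpow N)"
    using M'[of N] unfolding N_def by auto
  moreover have "n2 = p" using conj_mat_carrier[of S2 n2 T2 Y'] calculation ZN'
    unfolding inverse_pair_def by (metis carrier_matD(1))
  ultimately have i2: "inverse_pair p S2 T2" and Yc': "Y' \<in> carrier_mat p p" by auto
  \<comment> \<open>The given similarity, extended by the identity on the padding.\<close>
  define K L where "K = dsum 0 S (1\<^sub>m (N * d))" and "L = dsum 0 T (1\<^sub>m (N * d))"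
  have iK: "inverse_pair p K L"
    unfolding K_def L_def p_def by (rule inverse_pair_dsum[OF ST inverse_pair_one])
  have KL: "conj_mat K L (dsum 0 A (Xpow N)) = dsum 0 (conj_mat S T A) (Xpow N)"
    if "A \<in> carrier_mat n n" for A
    unfolding K_def L_def using that ST' XN
    by (simp add: conj_mat_dsum[of _ n _ "N * d"] conj_mat_one)
  have carr: "K \<in> carrier_mat p p" "L \<in> carrier_mat p p" "S1 \<in> carrier_mat p p" "T1 \<in> carrier_mat p p"
    "S2 \<in> carrier_mat p p" "T2 \<in> carrier_mat p p"
    using iK i1 i2 unfolding inverse_pair_def by auto
  have fY: "f Y \<in> carrier_mat p p" and fY': "f Y' \<in> carrier_mat p p"
    using Y(1) Yc Y'(1) Yc' mem_cases by (metis carrier_matD(1))+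
  \<comment> \<open>The route from \<open>Y\<close> to \<open>Y'\<close>: to padded \<open>Z\<close>
    by \<open>S1\<close>, to its padded conjugate by \<open>K\<close>, then back by the inverse
    \<open>T2\<close> of \<open>S2\<close>.\<close>
  define U V where "U = T2 * (K * S1)" and "V = (T1 * L) * S2"
  have iU: "inverse_pair p U V"
    unfolding U_def V_def by (intro inverse_pair_mult i1 iK inverse_pair_sym[OF i2])
  have U: "conj_mat U V A = conj_mat T2 S2 (conj_mat K L (conj_mat S1 T1 A))"
    if "A \<in> carrier_mat p p" for A
    unfolding U_def V_def using that carr by (simp add: conj_mat_mult[of _ p])
  have UY: "conj_mat U V Y = Y'"
    using U[OF Yc] Y(2) KL[OF Z] Y'(2) conj_mat_inverse[OF i2 Yc'] by simp
  \<comment> \<open>Both matrices lie in \<open>\<Omega>\<close>, so the similarity invariance of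
    \<open>f\<close> applies here.\<close>
  then have "f Y' = conj_mat U V (f Y)"
    using f_conj_mat[OF iU Y(1) Yc] Y'(1) by simp
  then have "conj_mat S2 T2 (f Y') = conj_mat K L (conj_mat S1 T1 (f Y))"
    using U[OF fY] conj_mat_inverse[OF inverse_pair_sym[OF i2]] carr fY by simp
  then have "dsum 0 W' (Xpow N) = dsum 0 (conj_mat S T W) (Xpow N)"
    using Y'(3) Y(3) KL[OF W] by simp
  then show ?thesis by (rule dsum_cancel(1)[OF W' conj_mat_carrier[OF ST' W] XN XN])
qed

text \<open>The identity similarity compares two images of the same matrix.\<close>

lemma ext_unique:
  assumes "ext Z W" "ext Z W'"
  shows "W' = W"
proof -
  obtain n where n: "Z \<in> carrier_mat n n" "W \<in> carrier_mat n n"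
    using ext_carrier[OF assms(1)] by metis
  show ?thesis
    using ext_conj_mat[OF assms(1) _ inverse_pair_one n(1), unfolded conj_mat_one[OF n(1)], OF assms(2)]
    unfolding conj_mat_one[OF n(2)] .
qed

theorem nc_extension:
  "\<exists>\<Omega>' f'. nc_set \<Omega>' \<and> \<Omega> \<subseteq> \<Omega>' \<and> nc_supp \<Omega>' = {k * d | k. 1 \<le> k} \<and> f' ` \<Omega>' \<subseteq> \<Omega>'
     \<and> nc_function lscale rscale lscale rscale \<Omega>' f' \<and> (\<forall>X\<in>\<Omega>. f' X = f X)
     \<and> (\<forall>n\<in>{k * d | k. 1 \<le> k}. is_unique_fixpoint f' (level \<Omega>' n) (Xpow (n div d)))"
proof -
  \<comment> \<open>The domain of the graph \<open>ext\<close>; by \<open>ext_unique\<close> the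
    definite description below is meaningful on it.\<close>
  define \<Omega>' where "\<Omega>' = {Z. \<exists>W. ext Z W}"
  define f' where "f' Z = (THE W. ext Z W)" for Z
  have f': "f' Z = W" if "ext Z W" for Z W
    unfolding f'_def using that ext_unique by blast
  have mem: "ext Z (f' Z)" if "Z \<in> \<Omega>'" for Z using that f' unfolding \<Omega>'_def by blast
  have memI: "Z \<in> \<Omega>'" if "ext Z W" for Z W using that unfolding \<Omega>'_def by blast
  have f'_carrier: "f' Z \<in> carrier_mat n n" if "Z \<in> \<Omega>'" "Z \<in> carrier_mat n n" for Z n
    using ext_carrier[OF mem[OF that(1)]] that(2) by (metis carrier_matD(1))
  have "nc_set \<Omega>'"
  proof -
    have "Z \<in> nc_space" if Z: "Z \<in> \<Omega>'" for Z
    proof -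
      obtain k where "k \<ge> 1" "Z \<in> carrier_mat (k * d) (k * d)" using ext_carrier[OF mem[OF Z]] by blast
      then show ?thesis unfolding nc_space_def using d_pos by (auto intro!: bexI[of _ "k * d"])
    qed
    then show ?thesis unfolding nc_set_def dsum_closed_def using memI ext.dsum mem by blast
  qed
  moreover have "\<Omega> \<subseteq> \<Omega>'" using memI ext.base by blast
  moreover have "nc_supp \<Omega>' = {k * d | k. 1 \<le> k}"
  proof (intro equalityI subsetI)
    fix n assume "n \<in> nc_supp \<Omega>'"
    then obtain Z where "Z \<in> \<Omega>'" "Z \<in> carrier_mat n n" unfolding nc_supp_def level_def by auto
    then show "n \<in> {k * d | k. 1 \<le> k}" using ext_carrier[OF mem] by (metis (mono_tags, lifting) carrier_matD(1) mem_Collect_eq)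
  next
    fix n assume "n \<in> {k * d | k. 1 \<le> k}"
    then obtain k where k: "k \<ge> 1" "n = k * d" by blast
    then have "Xpow k \<in> level \<Omega>' n" using memI[OF ext_Xpow] Xpow_carrier by (simp add: mem_level)
    then show "n \<in> nc_supp \<Omega>'" unfolding nc_supp_def using k d_pos by auto
  qed
  moreover have "f' ` \<Omega>' \<subseteq> \<Omega>'" using ext_closed mem memI by blast
  moreover have "nc_function lscale rscale lscale rscale \<Omega>' f'"
    unfolding nc_function_def
  proof (intro conjI)
    show "\<forall>n. f' ` level \<Omega>' n \<subseteq> carrier_mat n n" using f'_carrier by (auto simp: mem_level)
    show "respects_dsum 0 0 \<Omega>' f'"
      unfolding respects_dsum_def using f' ext.dsum mem by blast
    have "f' (conj_mat S T X) = conj_mat S T (f' X)"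
      if "X \<in> level \<Omega>' n" "inverse_pair n S T" "conj_mat S T X \<in> level \<Omega>' n" for n S T X
      using that ext_conj_mat[OF mem mem] by (simp add: mem_level)
    then show "respects_sim lscale rscale lscale rscale \<Omega>' f'"
      unfolding respects_sim_def conj_mat_def inverse_pair_def by blast
  qed
  moreover have "f' X = f X" if "X \<in> \<Omega>" for X using f' ext.base that by blast
  moreover have "is_unique_fixpoint f' (level \<Omega>' n) (Xpow (n div d))"
    if "n \<in> {k * d | k. 1 \<le> k}" for n
  proof -
    obtain k where k: "k \<ge> 1" "n = k * d" using \<open>n \<in> _\<close> by blast
    then have nk: "n div d = k" using d_pos by simp
    \<comment> \<open>A fixed point satisfies \<open>ext y y\<close>, hence is \<open>Xpow l\<close>
      for some \<open>l\<close>; comparing sizes and cancelling \<open>d > 0\<close> gives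
      \<open>l = k\<close>.\<close>
    have "y = Xpow k" if y: "y \<in> level \<Omega>' n" "f' y = y" for y
    proof -
      have y': "ext y y" "y \<in> carrier_mat n n" using y mem[of y] by (auto simp: mem_level)
      then obtain l where l: "y = Xpow l" using ext_fixed by blast
      then have "l * d = k * d" using y'(2) Xpow_carrier[of l] k(2) by (metis carrier_matD(1))
      then show ?thesis using l d_pos by simp
    qed
    moreover have "Xpow k \<in> level \<Omega>' n"
      using memI[OF ext_Xpow[OF k(1)]] Xpow_carrier[of k] k(2) by (simp add: mem_level)
    ultimately show ?thesis
      unfolding is_unique_fixpoint_def nk using f'[OF ext_Xpow[OF k(1)]] by blast
  qed
  ultimately show ?thesis
    by (intro exI[of _ \<Omega>'] exI[of _ f'] conjI ballI)
qed

end

section \<open>Common summand over an arbitrary set, and nc extension over a bimodule\<close>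

theorem theorem5:
  fixes lscale :: "'r::unital_ring \<Rightarrow> 'm::ab_group_add \<Rightarrow> 'm"
    and rscale :: "'m \<Rightarrow> 'r \<Rightarrow> 'm"
  shows
    "(\<forall>(z::'a) (\<Omega> :: 'a mat set) (f :: 'a mat \<Rightarrow> 'a mat) (Xfix :: nat \<Rightarrow> 'a mat) (d :: nat).
        \<Omega> \<subseteq> nc_space \<and> \<Omega> \<noteq> {} \<and> dsum_closed z \<Omega>
        \<and> (\<forall>n\<in>nc_supp \<Omega>. f ` level \<Omega> n \<subseteq> level \<Omega> n)
        \<and> respects_dsum z z \<Omega> f
        \<and> (\<forall>n\<in>nc_supp \<Omega>. is_unique_fixpoint f (level \<Omega> n) (Xfix n))
        \<and> d = Gcd (nc_supp \<Omega>)
        \<longrightarrow> (\<exists>Xs\<in>carrier_mat d d. \<forall>n\<in>nc_supp \<Omega>. Xfix n = dsum_copies z (n div d) Xs))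
     \<and>
     (\<forall>(\<Omega> :: 'm mat set) (f :: 'm mat \<Rightarrow> 'm mat) (Xfix :: nat \<Rightarrow> 'm mat) (d :: nat).
        \<Omega> \<subseteq> nc_space \<and> \<Omega> \<noteq> {} \<and> dsum_closed 0 \<Omega>
        \<and> (\<forall>n\<in>nc_supp \<Omega>. f ` level \<Omega> n \<subseteq> level \<Omega> n)
        \<and> respects_dsum 0 0 \<Omega> f
        \<and> (\<forall>n\<in>nc_supp \<Omega>. is_unique_fixpoint f (level \<Omega> n) (Xfix n))
        \<and> d = Gcd (nc_supp \<Omega>)
        \<and> bimodule lscale rscale
        \<and> nc_function lscale rscale lscale rscale \<Omega> f
        \<longrightarrow> (\<exists>Xs\<in>carrier_mat d d.
              (\<forall>n\<in>nc_supp \<Omega>. Xfix n = dsum_copies 0 (n div d) Xs)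
              \<and> (\<exists>\<Omega>' f'.
                   nc_set \<Omega>' \<and> \<Omega> \<subseteq> \<Omega>' \<and> nc_supp \<Omega>' = {k * d | k. 1 \<le> k}
                   \<and> f' ` \<Omega>' \<subseteq> \<Omega>'
                   \<and> nc_function lscale rscale lscale rscale \<Omega>' f'
                   \<and> (\<forall>X\<in>\<Omega>. f' X = f X)
                   \<and> (\<forall>n\<in>{k * d | k. 1 \<le> k}.
                        is_unique_fixpoint f' (level \<Omega>' n) (dsum_copies 0 (n div d) Xs)))))"
proof (intro conjI allI impI)
  fix z :: 'a and \<Omega> :: "'a mat set" and f Xfix and d :: nat
  assume "\<Omega> \<subseteq> nc_space \<and> \<Omega> \<noteq> {} \<and> dsum_closed z \<Omega>
        \<and> (\<forall>n\<in>nc_supp \<Omega>. f ` level \<Omega> n \<subseteq> level \<Omega> n)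
        \<and> respects_dsum z z \<Omega> f
        \<and> (\<forall>n\<in>nc_supp \<Omega>. is_unique_fixpoint f (level \<Omega> n) (Xfix n))
        \<and> d = Gcd (nc_supp \<Omega>)"
  then interpret dsum_fixpoints z \<Omega> f Xfix d by unfold_locales auto
  show "\<exists>Xs\<in>carrier_mat d d. \<forall>n\<in>nc_supp \<Omega>. Xfix n = dsum_copies z (n div d) Xs"
    by (rule common_summand)
next
  fix \<Omega> :: "'m mat set" and f Xfix and d :: nat
  assume *: "\<Omega> \<subseteq> nc_space \<and> \<Omega> \<noteq> {} \<and> dsum_closed 0 \<Omega>
        \<and> (\<forall>n\<in>nc_supp \<Omega>. f ` level \<Omega> n \<subseteq> level \<Omega> n)
        \<and> respects_dsum 0 0 \<Omega> f
        \<and> (\<forall>n\<in>nc_supp \<Omega>. is_unique_fixpoint f (level \<Omega> n) (Xfix n))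
        \<and> d = Gcd (nc_supp \<Omega>)
        \<and> bimodule lscale rscale
        \<and> nc_function lscale rscale lscale rscale \<Omega> f"
  then have fixpts: "dsum_fixpoints 0 \<Omega> f Xfix d" by unfold_locales auto
  \<comment> \<open>\<open>Xs\<close> is chosen before the extension is built, so one matrix
    describes the fixed points of both \<open>f\<close> and its extension.\<close>
  obtain Xs where Xs: "Xs \<in> carrier_mat d d" "\<forall>n\<in>nc_supp \<Omega>. Xfix n = dsum_copies 0 (n div d) Xs"
    using dsum_fixpoints.common_summand[OF fixpts] by blast
  then have "nc_fixpoints \<Omega> f Xfix d lscale rscale Xs"
    using * fixpts unfolding nc_fixpoints_def nc_fixpoints_axioms_def nc_function_def by blast
  then show "\<exists>Xs\<in>carrier_mat d d.
              (\<forall>n\<in>nc_supp \<Omega>. Xfix n = dsum_copies 0 (n div d) Xs)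
              \<and> (\<exists>\<Omega>' f'.
                   nc_set \<Omega>' \<and> \<Omega> \<subseteq> \<Omega>' \<and> nc_supp \<Omega>' = {k * d | k. 1 \<le> k}
                   \<and> f' ` \<Omega>' \<subseteq> \<Omega>'
                   \<and> nc_function lscale rscale lscale rscale \<Omega>' f'
                   \<and> (\<forall>X\<in>\<Omega>. f' X = f X)
                   \<and> (\<forall>n\<in>{k * d | k. 1 \<le> k}.
                        is_unique_fixpoint f' (level \<Omega>' n) (dsum_copies 0 (n div d) Xs)))"
    by (intro bexI[OF _ Xs(1)] conjI[OF Xs(2)]) (rule nc_fixpoints.nc_extension)
qed

end
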